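(* Let $\theta_{PNC}=\{UPU,\,UPR\}$, a set of meta-paths of the tripartite preference graph (TPG), and let $g_{PNC}$ be the projection of TPG over $\theta_{PNC}$. Then the set of all recommendation meta-paths (from $U$ to $R$) in $g_{PNC}$, each read as a meta-path of TPG by expanding every edge of the schema of $g_{PNC}$ into the meta-path of $\theta_{PNC}$ it represents, is the set of meta-paths described by the string description $$strdesc_{PNC}=U(PUP)^*R .$$
   Context: TPG schema. The tripartite preference graph (TPG) is a graph with three node types: $U$ (users), $P$ (pairwise preferences), $R$ (item representatives). Its undirected edges join users to preferences and preferences to representatives. Its network schema is therefore the directed graph on the vertex set $\{U,P,R\}$ with edges $(U,P),(P,U),(P,R),(R,P)$. Meta-paths. A meta-path of a network is a walk $v_1v_2\cdots v_n$ ($n\ge 1$) in its network schema, i.e. each $(v_i,v_{i+1})$ is an edge of the schema; it is written as the string $v_1v_2\cdots v_n$. A recommendation meta-path (for the query $(U,R)$) is a meta-path with $v_1=U$ and $v_n=R$. Projection. The projection of TPG over a finite set $\theta$ of meta-paths of TPG is a graph whose network schema has as vertices the starting and ending node types of the members of $\theta$, and as edges the pairs $(\pi.\mathrm{start},\pi.\mathrm{end})$ for $\pi\in\theta$. The edge $(\pi.\mathrm{start},\pi.\mathrm{end})$ represents the meta-path $\pi$ of TPG. For the $\theta$ used here, distinct members of $\theta$ give distinct edges. A meta-path of the projection is expanded into a meta-path of TPG by replacing each edge by the meta-path in $\theta$ that it represents and joining these consecutively. String descriptions. A string description denotes a set of strings over the node types. The join of strings $\alpha=t_1\cdots t_m$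 and $\beta=t'_1\cdots t'_n$ is defined when $t_m=t'_1$ and is $\alpha.\beta=t_1\cdots t_m t'_2\cdots t'_n$ (the shared node type is written once); joins of sets of strings are taken elementwise. If a string $\alpha$ starts and ends with the same type $t$, then $\alpha^*$ is the set of all joins of $k\ge 0$ copies of $\alpha$, where the join of $0$ copies is the one-letter string $t$. The expression $U(PUP)^*R$ abbreviates the join $UP.\,(PUP)^*.\,PR$, i.e. the strings obtained from a string of $(PUP)^*$ by prepending $U$ and appending $R$. *)

theory Defs
  imports "Graph_Theory.Graph_Theory"
begin

text \<open>
  A network schema is a digraph without parallel arcs on a set of node types; strings over the
  node types are lists, and meta-paths are vertex walks, which by the definition of
  \<^const>\<open>vwalk\<close> are nonempty.
\<close>

definition meta_paths :: "'t pair_pre_digraph \<Rightarrow> 't list set" where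
  "meta_paths S = {w. vwalk w (with_proj S)}"

definition recommendation_meta_paths :: "'t \<Rightarrow> 't \<Rightarrow> 't pair_pre_digraph \<Rightarrow> 't list set" where
  "recommendation_meta_paths s t S = {w \<in> meta_paths S. hd w = s \<and> last w = t}"

definition ends :: "'t list \<Rightarrow> 't \<times> 't" where
  "ends \<pi> = (hd \<pi>, last \<pi>)"

definition projection_schema :: "'t list set \<Rightarrow> 't pair_pre_digraph" where
  "projection_schema \<theta> = \<lparr> pverts = hd ` \<theta> \<union> last ` \<theta>, parcs = ends ` \<theta> \<rparr>"

text \<open>Only meaningful if distinct members of \<open>\<theta>\<close> have distinct \<^const>\<open>ends\<close>.\<close>

definition represented :: "'t list set \<Rightarrow> 't \<times> 't \<Rightarrow> 't list" where
  "represented \<theta> e = (THE \<pi>. \<pi> \<in> \<theta> \<and> ends \<pi> = e)"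

text \<open>
  The join of strings is \<^const>\<open>vwalk_join\<close>, written \<open>\<alpha> \<oplus> \<beta>\<close>. It is a total function, with
  the intended meaning only for \<^const>\<open>joinable\<close> arguments.
\<close>

definition join_sets :: "'t list set \<Rightarrow> 't list set \<Rightarrow> 't list set" where
  "join_sets A B = {\<alpha> \<oplus> \<beta> | \<alpha> \<beta>. \<alpha> \<in> A \<and> \<beta> \<in> B \<and> joinable \<alpha> \<beta>}"

text \<open>The empty string, which is not a meta-path, is expanded to itself.\<close>

fun expand :: "'t list set \<Rightarrow> 't list \<Rightarrow> 't list" where
  "expand \<theta> [] = []"
| "expand \<theta> [v] = [v]"
| "expand \<theta> (u # v # w) = represented \<theta> (u, v) \<oplus> expand \<theta> (v # w)"

text \<open>
  Copies of a string \<open>\<alpha>\<close> with \<open>\<alpha> \<noteq> []\<close> and \<open>hd \<alpha> = last \<alpha>\<close>: the join of no copies is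
  the one-letter string consisting of this common end.
\<close>

primrec join_copies :: "nat \<Rightarrow> 't list \<Rightarrow> 't list" where
  "join_copies 0 \<alpha> = [hd \<alpha>]"
| "join_copies (Suc k) \<alpha> = \<alpha> \<oplus> join_copies k \<alpha>"

definition star :: "'t list \<Rightarrow> 't list set" where
  "star \<alpha> = {join_copies k \<alpha> | k. True}"

datatype node_type = User | Pref | Rep

definition TPG_schema :: "node_type pair_pre_digraph" where
  "TPG_schema =
     \<lparr> pverts = {User, Pref, Rep},
       parcs = {(User, Pref), (Pref, User), (Pref, Rep), (Rep, Pref)} \<rparr>"

definition theta_PNC :: "node_type list set" where
  "theta_PNC = {[User, Pref, User], [User, Pref, Rep]}"

definition g_PNC :: "node_type pair_pre_digraph" where
  "g_PNC = projection_schema theta_PNC"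

definition strdesc_PNC :: "node_type list set" where
  "strdesc_PNC = join_sets {[User, Pref]} (join_sets (star [Pref, User, Pref]) {[Pref, Rep]})"

lemma theta_PNC_meta_paths: "theta_PNC \<subseteq> meta_paths TPG_schema"
  by (auto simp: theta_PNC_def meta_paths_def TPG_schema_def vwalk_def)

lemma inj_on_ends_theta_PNC: "inj_on ends theta_PNC"
  by (auto simp: theta_PNC_def ends_def)

lemma represented_eqI:
  assumes "inj_on ends \<theta>" and "\<pi> \<in> \<theta>"
  shows "represented \<theta> (ends \<pi>) = \<pi>"
  unfolding represented_def using assms by (auto dest: inj_onD)

text \<open>The expansion of a meta-path of a projection is a meta-path with the same ends.\<close>

lemma expand_meta_path:
  assumes \<theta>: "\<theta> \<subseteq> meta_paths S" and inj: "inj_on ends \<theta>"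
    and w: "w \<in> meta_paths (projection_schema \<theta>)"
  shows "expand \<theta> w \<in> meta_paths S \<and> ends (expand \<theta> w) = ends w"
  using w
proof (induction w rule: induct_list012)
  case 1
  then show ?case by (simp add: meta_paths_def vwalk_def)
next
  case (2 v)
  then have "v \<in> hd ` \<theta> \<union> last ` \<theta>"
    by (simp add: meta_paths_def vwalk_def projection_schema_def)
  moreover have "\<pi> \<noteq> [] \<and> set \<pi> \<subseteq> pverts S" if "\<pi> \<in> \<theta>" for \<pi>
    using that \<theta> by (auto simp: meta_paths_def vwalk_def)
  ultimately have "v \<in> pverts S"
    using hd_in_set last_in_set by blast
  then show ?case by (simp add: meta_paths_def vwalk_def)
next
  case (3 u v w)
  then have "(u, v) \<in> ends ` \<theta>" and vw: "v # w \<in> meta_paths (projection_schema \<theta>)"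
    by (auto simp: meta_paths_def vwalk_def projection_schema_def)
  then obtain \<pi> where \<pi>: "\<pi> \<in> \<theta>" "ends \<pi> = (u, v)" by force
  then have rep: "represented \<theta> (u, v) = \<pi>"
    using represented_eqI[OF inj] by metis
  let ?e = "expand \<theta> (v # w)"
  have e: "vwalk ?e (with_proj S)" "ends ?e = ends (v # w)"
    using "3.IH"(2)[OF vw] by (auto simp: meta_paths_def)
  have p: "vwalk \<pi> (with_proj S)"
    using \<pi> \<theta> by (auto simp: meta_paths_def)
  have j: "joinable \<pi> ?e"
    using e p \<pi>(2) by (auto simp: joinable_def ends_def vwalk_def)
  show ?case
    using vwalk_joinI_vwalk[OF p e(1) j] vwalk_join_hd[OF j] vwalk_join_last[OF j] e(2) \<pi>(2) rep
    by (simp add: meta_paths_def ends_def)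
qed

end

theory Submission
  imports Defs
begin

text \<open>The schema of \<open>g_PNC\<close> has just two arcs, a loop at \<open>User\<close> and
  an arc from \<open>User\<close> to the sink \<open>Rep\<close>. So a recommendation meta-path is
  determined by the number k of times it runs through the loop
  (\<open>recommendation_meta_paths_g_PNC\<close>), and its expansion is U(PU)^k PR
  (\<open>expand_replicate_PNC\<close>). Joining UP, k copies of PUP, and PR gives UP(UP)^k R. The
  two strings agree for each k because P(UP)^k = (PU)^k P (\<open>concat_replicate_shift\<close>),
  so both sets are the same range over k (\<open>strdesc_PNC_eq\<close>).\<close>

lemma parcs_g_PNC: "parcs g_PNC = {(User, User), (User, Rep)}"
  by (auto simp: g_PNC_def projection_schema_def theta_PNC_def ends_def)

lemma pverts_g_PNC: "pverts g_PNC = {User, Rep}"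
  by (auto simp: g_PNC_def projection_schema_def theta_PNC_def)

lemma represented_PNC:
  "represented theta_PNC (User, User) = [User, Pref, User]"
  "represented theta_PNC (User, Rep) = [User, Pref, Rep]"
  using represented_eqI[OF inj_on_ends_theta_PNC, of "[User, Pref, User]"]
    represented_eqI[OF inj_on_ends_theta_PNC, of "[User, Pref, Rep]"]
  by (simp_all add: theta_PNC_def ends_def)

text \<open>Every arc starts at \<open>User\<close>, so \<open>Rep\<close> can occur only as the
  final letter.\<close>

lemma meta_path_g_PNC_replicate:
  assumes "w \<in> meta_paths g_PNC" "hd w = User" "last w = Rep"
  shows "\<exists>k. w = replicate (Suc k) User @ [Rep]"
  using assms
proof (induction w rule: induct_list012)
  case 1
  then show ?case by (simp add: meta_paths_def vwalk_def)
next
  case (2 v)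
  then show ?case by simp
next
  case (3 u v w)
  have vw: "v # w \<in> meta_paths g_PNC" and arc: "(u, v) \<in> {(User, User), (User, Rep)}"
    using "3.prems"(1) by (auto simp: meta_paths_def vwalk_def parcs_g_PNC)
  show ?case
  proof (cases "v = User")
    case True
    then obtain k where "v # w = replicate (Suc k) User @ [Rep]"
      using "3.IH"(2)[OF vw] "3.prems"(3) by auto
    then show ?thesis
      using arc True by (intro exI[of _ "Suc k"]) auto
  next
    case False
    with arc have "u = User" "v = Rep" by auto
    \<comment> \<open>\<open>Rep\<close> has no outgoing arc, so the walk stops here.\<close>
    moreover have "w = []"
      using vw \<open>v = Rep\<close> by (cases w) (auto simp: meta_paths_def vwalk_def parcs_g_PNC)
    ultimately show ?thesis
      by (intro exI[of _ 0]) simp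
  qed
qed

lemma replicate_in_meta_paths_g_PNC: "replicate (Suc k) User @ [Rep] \<in> meta_paths g_PNC"
  by (induction k) (auto simp: meta_paths_def vwalk_def parcs_g_PNC pverts_g_PNC)

lemma recommendation_meta_paths_g_PNC:
  "recommendation_meta_paths User Rep g_PNC = range (\<lambda>k. replicate (Suc k) User @ [Rep])"
  using meta_path_g_PNC_replicate replicate_in_meta_paths_g_PNC
  by (fastforce simp: recommendation_meta_paths_def)

text \<open>Since a shared \<open>User\<close> is written once, each loop adds PU and the final arc
  adds PR.\<close>

lemma expand_replicate_PNC:
  "expand theta_PNC (replicate (Suc k) User @ [Rep]) =
     User # concat (replicate k [Pref, User]) @ [Pref, Rep]"
  by (induction k) (simp_all add: represented_PNC vwalk_join_def)

text \<open>A join drops the first letter of its right argument, so after the initial letter each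
  copy contributes only its tail.\<close>

lemma join_copies_eq_concat:
  assumes "\<alpha> \<noteq> []"
  shows "join_copies k \<alpha> = hd \<alpha> # concat (replicate k (tl \<alpha>))"
  using assms by (induction k) (simp_all add: vwalk_join_def)

lemma concat_replicate_shift:
  "x # concat (replicate k [y, x]) = concat (replicate k [x, y]) @ [x]"
  by (induction k) simp_all

lemma join_sets_singleton_left:
  assumes "\<And>\<beta>. \<beta> \<in> B \<Longrightarrow> joinable \<alpha> \<beta>"
  shows "join_sets {\<alpha>} B = (\<oplus>) \<alpha> ` B"
  using assms by (auto simp: join_sets_def)

lemma join_sets_singleton_right:
  assumes "\<And>\<alpha>. \<alpha> \<in> A \<Longrightarrow> joinable \<alpha> \<beta>"
  shows "join_sets A {\<beta>} = (\<lambda>\<alpha>. \<alpha> \<oplus> \<beta>) ` A"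
  using assms by (auto simp: join_sets_def)

lemma strdesc_PNC_eq:
  "strdesc_PNC = range (\<lambda>k. User # concat (replicate k [Pref, User]) @ [Pref, Rep])"
proof -
  have "star [Pref, User, Pref] = range (\<lambda>k. Pref # concat (replicate k [User, Pref]))"
    by (auto simp: star_def join_copies_eq_concat)
  \<comment> \<open>Needed for joinability with PR; regrouping as (PU)^k P exposes the last
    letter.\<close>
  moreover have "last (Pref # concat (replicate k [User, Pref])) = Pref" for k
    by (simp only: concat_replicate_shift last_snoc)
  ultimately have "join_sets (star [Pref, User, Pref]) {[Pref, Rep]} =
      range (\<lambda>k. Pref # concat (replicate k [User, Pref]) @ [Rep])"
    by (subst join_sets_singleton_right) (auto simp: joinable_def vwalk_join_def image_image)
  then have "strdesc_PNC = range (\<lambda>k. User # Pref # concat (replicate k [User, Pref]) @ [Rep])"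
    unfolding strdesc_PNC_def
    by (subst join_sets_singleton_left) (auto simp: joinable_def vwalk_join_def image_image)
  \<comment> \<open>Regroups the letters to match the form of the expanded walks.\<close>
  moreover have "Pref # concat (replicate k [User, Pref]) @ [Rep] =
      concat (replicate k [Pref, User]) @ [Pref, Rep]" for k
    using concat_replicate_shift[of Pref k User] by (metis append_Cons append_Nil append_assoc)
  ultimately show ?thesis by simp
qed

theorem mainTheorem2:
  shows "expand theta_PNC ` recommendation_meta_paths User Rep g_PNC = strdesc_PNC"
  unfolding recommendation_meta_paths_g_PNC strdesc_PNC_eq image_image expand_replicate_PNC ..

end
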